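(* Let $X$ and $Y$ be nonempty sets and let $F:X\times Y\to\mathbb{R}$ be a bridge on the disjoint union $X\amalg Y$. Then $$\kappa=\hat\kappa_X\amalg F\amalg{}^tF\amalg\hat\kappa_Y$$ is a symmetric distance on $X\amalg Y$. Here $\kappa$ is the function on $(X\amalg Y)\times(X\amalg Y)$ equal to $\hat\kappa_X$ on $X\times X$, to $F$ on $X\times Y$, to ${}^tF(y,x)=F(x,y)$ on $Y\times X$, and to $\hat\kappa_Y$ on $Y\times Y$.
   Context: A bridge on $X\amalg Y$ is a function $F:X\times Y\to\mathbb{R}$ satisfying $F(x_1,y_1)-F(x_2,y_2)\le F(x_1,y_2)+F(x_2,y_1)$ for all $x_1,x_2\in X$, $y_1,y_2\in Y$ (it follows that $F\ge0$). It induces kernels $$\kappa_X(x_1,x_2)=\inf\{F(x_1,y)+F(x_2,y):y\in Y\},\qquad \kappa_Y(y_1,y_2)=\inf\{F(x,y_1)+F(x,y_2):x\in X\}.$$ A distance on a set $Z$ is a function $\kappa:Z\times Z\to\mathbb{R}$ with $\kappa\ge0$ and $\kappa(a,c)\le\kappa(a,b)+\kappa(b,c)$ for all $a,b,c\in Z$ (it need not vanish on the diagonal). For a non-negative function $\kappa$ on $Z\times Z$, $$\hat\kappa(a,b)=\inf\Big\{\sum_{i=0}^{n-1}\kappa(z_i,z_{i+1}) : n\in\mathbb{N},\ n\ge1,\ z_0,\dots,z_n\in Z,\ z_0=a,\ z_n=b\Big\},$$ the largest distance $\le\kappa$. *)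

theory Defs
  imports Complex_Main
begin

text \<open>Functions on a product \<open>A \<times> B\<close> are curried total functions, considered only on the
  carriers \<open>A\<close> and \<open>B\<close>; their values outside play no role. The disjoint union of \<open>X\<close> and \<open>Y\<close>
  is \<open>X <+> Y\<close>.\<close>

definition bridge :: "'a set \<Rightarrow> 'b set \<Rightarrow> ('a \<Rightarrow> 'b \<Rightarrow> real) \<Rightarrow> bool" where
  "bridge X Y F \<longleftrightarrow>
    (\<forall>x1\<in>X. \<forall>x2\<in>X. \<forall>y1\<in>Y. \<forall>y2\<in>Y. F x1 y1 - F x2 y2 \<le> F x1 y2 + F x2 y1)"

definition kernel_left :: "'b set \<Rightarrow> ('a \<Rightarrow> 'b \<Rightarrow> real) \<Rightarrow> 'a \<Rightarrow> 'a \<Rightarrow> real" where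
  "kernel_left Y F x1 x2 = (INF y\<in>Y. F x1 y + F x2 y)"

definition kernel_right :: "'a set \<Rightarrow> ('a \<Rightarrow> 'b \<Rightarrow> real) \<Rightarrow> 'b \<Rightarrow> 'b \<Rightarrow> real" where
  "kernel_right X F y1 y2 = (INF x\<in>X. F x y1 + F x y2)"

definition distance_on :: "'c set \<Rightarrow> ('c \<Rightarrow> 'c \<Rightarrow> real) \<Rightarrow> bool" where
  "distance_on Z k \<longleftrightarrow>
    (\<forall>a\<in>Z. \<forall>b\<in>Z. 0 \<le> k a b) \<and>
    (\<forall>a\<in>Z. \<forall>b\<in>Z. \<forall>c\<in>Z. k a c \<le> k a b + k b c)"

definition symmetric_on :: "'c set \<Rightarrow> ('c \<Rightarrow> 'c \<Rightarrow> real) \<Rightarrow> bool" where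
  "symmetric_on Z k \<longleftrightarrow> (\<forall>a\<in>Z. \<forall>b\<in>Z. k a b = k b a)"

text \<open>The infimum runs over chains with at least one step, so \<open>hat Z k a a\<close> need not be 0.\<close>

definition hat :: "'c set \<Rightarrow> ('c \<Rightarrow> 'c \<Rightarrow> real) \<Rightarrow> 'c \<Rightarrow> 'c \<Rightarrow> real" where
  "hat Z k a b = Inf {(\<Sum>i<n. k (z i) (z (Suc i))) | (n::nat) (z::nat \<Rightarrow> 'c).
     1 \<le> n \<and> (\<forall>i\<le>n. z i \<in> Z) \<and> z 0 = a \<and> z n = b}"

definition transposed :: "('a \<Rightarrow> 'b \<Rightarrow> real) \<Rightarrow> 'b \<Rightarrow> 'a \<Rightarrow> real" where
  "transposed F y x = F x y"

fun glue :: "('a \<Rightarrow> 'a \<Rightarrow> real) \<Rightarrow> ('a \<Rightarrow> 'b \<Rightarrow> real) \<Rightarrow> ('b \<Rightarrow> 'a \<Rightarrow> real) \<Rightarrow> ('b \<Rightarrow> 'b \<Rightarrow> real)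
    \<Rightarrow> 'a + 'b \<Rightarrow> 'a + 'b \<Rightarrow> real" where
  "glue p f g q (Inl x1) (Inl x2) = p x1 x2"
| "glue p f g q (Inl x) (Inr y) = f x y"
| "glue p f g q (Inr y) (Inl x) = g y x"
| "glue p f g q (Inr y1) (Inr y2) = q y1 y2"

end

theory Submission
  imports Defs
begin

text \<open>Write \<open>k\<close> for one of the two kernels of \<open>F\<close>. A triangle in the disjoint union has either all
  three vertices on one side, where its inequality is the one for \<open>hat k\<close>, or exactly one vertex
  on the opposite side. In the latter case, up to symmetry, there are two inequalities:
  \<open>hat k x1 x2 \<le> F x1 y + F x2 y\<close>, which holds because \<open>hat k \<le> k\<close> and \<open>k\<close> is an infimum of such
  sums, and \<open>F x1 y \<le> hat k x1 x2 + F x2 y\<close>. For the latter, the bridge condition says precisely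
  that \<open>F x1 y - F x2 y \<le> F x1 y' + F x2 y'\<close> for every \<open>y'\<close>, that is, \<open>F x1 y - F x2 y \<le> k x1 x2\<close>.
  The left-hand side telescopes along chains, so it is bounded by \<open>hat k x1 x2\<close> too.

  This last step is one instance of the maximality of \<open>hat k\<close> (lemma \<open>hat_greatest\<close>) among all
  functions below \<open>k\<close> that satisfy the triangle inequality. It is important there not to ask for
  non-negative functions, since differences such as \<open>F x1 y - F x2 y\<close> change sign. With that
  generality the triangle inequality and the symmetry of \<open>hat k\<close> are further instances. The
  statements for \<open>Y\<close> are those for \<open>X\<close> applied to the transposed function.\<close>

lemma hat_le_chain_sum:
  fixes k :: "'c \<Rightarrow> 'c \<Rightarrow> real" and n :: nat
  assumes nonneg: "\<And>a b. a \<in> Z \<Longrightarrow> b \<in> Z \<Longrightarrow> 0 \<le> k a b"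
    and "1 \<le> n" "\<forall>i\<le>n. z i \<in> Z"
  shows "hat Z k (z 0) (z n) \<le> (\<Sum>i<n. k (z i) (z (Suc i)))"
  unfolding hat_def
proof (rule cInf_lower)
  show "bdd_below {(\<Sum>i<m. k (w i) (w (Suc i))) | (m::nat) (w::nat \<Rightarrow> 'c).
      1 \<le> m \<and> (\<forall>i\<le>m. w i \<in> Z) \<and> w 0 = z 0 \<and> w m = z n}"
    by (rule bdd_belowI[of _ 0]) (auto intro!: sum_nonneg nonneg)
next
  show "(\<Sum>i<n. k (z i) (z (Suc i))) \<in> {(\<Sum>i<m. k (w i) (w (Suc i))) | (m::nat) (w::nat \<Rightarrow> 'c).
      1 \<le> m \<and> (\<forall>i\<le>m. w i \<in> Z) \<and> w 0 = z 0 \<and> w m = z n}"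
    unfolding mem_Collect_eq using assms(2,3) by (intro exI[of _ n] exI[of _ z]) simp
qed

lemma le_hatI:
  fixes k :: "'c \<Rightarrow> 'c \<Rightarrow> real"
  assumes "a \<in> Z" "b \<in> Z"
    and chain: "\<And>(n::nat) z. 1 \<le> n \<Longrightarrow> \<forall>i\<le>n. z i \<in> Z \<Longrightarrow> z 0 = a \<Longrightarrow> z n = b \<Longrightarrow>
      r \<le> (\<Sum>i<n. k (z i) (z (Suc i)))"
  shows "r \<le> hat Z k a b"
  unfolding hat_def
proof (rule cInf_greatest)
  \<comment> \<open>The one-step chain from \<open>a\<close> to \<open>b\<close> shows that the infimum is not taken over the empty set.\<close>
  have "k a b \<in> {(\<Sum>i<n. k (z i) (z (Suc i))) | (n::nat) (z::nat \<Rightarrow> 'c).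
      1 \<le> n \<and> (\<forall>i\<le>n. z i \<in> Z) \<and> z 0 = a \<and> z n = b}"
    unfolding mem_Collect_eq using assms(1,2)
    by (intro exI[of _ 1] exI[of _ "\<lambda>i. if i = 0 then a else b"]) simp
  then show "{(\<Sum>i<n. k (z i) (z (Suc i))) | (n::nat) (z::nat \<Rightarrow> 'c).
      1 \<le> n \<and> (\<forall>i\<le>n. z i \<in> Z) \<and> z 0 = a \<and> z n = b} \<noteq> {}"
    by (metis empty_iff)
qed (use chain in auto)

lemma hat_nonneg:
  fixes k :: "'c \<Rightarrow> 'c \<Rightarrow> real"
  assumes "\<And>a b. a \<in> Z \<Longrightarrow> b \<in> Z \<Longrightarrow> 0 \<le> k a b" "a \<in> Z" "b \<in> Z"
  shows "0 \<le> hat Z k a b"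
  by (rule le_hatI) (auto intro!: sum_nonneg assms)

lemma hat_le:
  fixes k :: "'c \<Rightarrow> 'c \<Rightarrow> real"
  assumes "\<And>a b. a \<in> Z \<Longrightarrow> b \<in> Z \<Longrightarrow> 0 \<le> k a b" "a \<in> Z" "b \<in> Z"
  shows "hat Z k a b \<le> k a b"
  using hat_le_chain_sum[of Z k 1 "\<lambda>i. if i = 0 then a else b"] assms by auto

text \<open>Along a chain, the triangle inequality for \<open>d\<close> bounds the value at the end points by the sum
  over the steps. As \<open>d\<close> may take negative values, the lemma applies to differences
  \<open>f a - f b\<close>.\<close>

lemma hat_greatest:
  fixes k d :: "'c \<Rightarrow> 'c \<Rightarrow> real"
  assumes triangle: "\<And>a b c. a \<in> Z \<Longrightarrow> b \<in> Z \<Longrightarrow> c \<in> Z \<Longrightarrow> d a c \<le> d a b + d b c"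
    and below: "\<And>a b. a \<in> Z \<Longrightarrow> b \<in> Z \<Longrightarrow> d a b \<le> k a b"
    and "a \<in> Z" "b \<in> Z"
  shows "d a b \<le> hat Z k a b"
proof (rule le_hatI)
  fix n :: nat and z :: "nat \<Rightarrow> 'c"
  assume "1 \<le> n" "\<forall>i\<le>n. z i \<in> Z" "z 0 = a" "z n = b"
  have "d (z 0) (z n) \<le> (\<Sum>i<n. k (z i) (z (Suc i)))"
    using \<open>1 \<le> n\<close> \<open>\<forall>i\<le>n. z i \<in> Z\<close>
  proof (induction n rule: dec_induct)
    case base
    then show ?case using below by simp
  next
    case (step m)
    have "d (z 0) (z (Suc m)) \<le> d (z 0) (z m) + d (z m) (z (Suc m))"
      using step.prems by (intro triangle) auto
    moreover have "d (z m) (z (Suc m)) \<le> k (z m) (z (Suc m))"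
      using step.prems by (intro below) auto
    ultimately show ?case using step by auto
  qed
  then show "d a b \<le> (\<Sum>i<n. k (z i) (z (Suc i)))"
    using \<open>z 0 = a\<close> \<open>z n = b\<close> by simp
qed fact+

text \<open>A step from \<open>a\<close> to \<open>b\<close> can be put in front of any chain from \<open>b\<close> to \<open>c\<close>. Maximality will
  turn this weak form of the triangle inequality, with \<open>k a b\<close> on the right, into the full one, so
  that longer chains never have to be concatenated.\<close>

lemma hat_le_step_plus_hat:
  fixes k :: "'c \<Rightarrow> 'c \<Rightarrow> real"
  assumes nonneg: "\<And>a b. a \<in> Z \<Longrightarrow> b \<in> Z \<Longrightarrow> 0 \<le> k a b"
    and "a \<in> Z" "b \<in> Z" "c \<in> Z"
  shows "hat Z k a c \<le> k a b + hat Z k b c"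
proof -
  have "hat Z k a c - k a b \<le> hat Z k b c"
  proof (rule le_hatI)
    fix n :: nat and z :: "nat \<Rightarrow> 'c"
    assume z: "1 \<le> n" "\<forall>i\<le>n. z i \<in> Z" "z 0 = b" "z n = c"
    have "\<forall>i\<le>Suc n. case_nat a z i \<in> Z"
      using z \<open>a \<in> Z\<close> by (auto split: nat.split)
    from hat_le_chain_sum[OF nonneg _ this]
    have "hat Z k a c \<le> k a b + (\<Sum>i<n. k (z i) (z (Suc i)))"
      using z by (simp add: sum.lessThan_Suc_shift del: sum.lessThan_Suc)
    then show "hat Z k a c - k a b \<le> (\<Sum>i<n. k (z i) (z (Suc i)))"
      by simp
  qed fact+
  then show ?thesis by simp
qed

text \<open>For fixed \<open>c\<close>, the difference \<open>hat Z k a c - hat Z k b c\<close> satisfies the triangle inequality in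
  \<open>a\<close> and \<open>b\<close> with equality, and prepending a step shows that it lies below \<open>k\<close>; by maximality it
  lies below \<open>hat Z k\<close>.\<close>

lemma hat_triangle:
  fixes k :: "'c \<Rightarrow> 'c \<Rightarrow> real"
  assumes nonneg: "\<And>a b. a \<in> Z \<Longrightarrow> b \<in> Z \<Longrightarrow> 0 \<le> k a b"
    and "a \<in> Z" "b \<in> Z" "c \<in> Z"
  shows "hat Z k a c \<le> hat Z k a b + hat Z k b c"
proof -
  have "hat Z k a c - hat Z k b c \<le> hat Z k a b"
  proof (rule hat_greatest[where d = "\<lambda>a b. hat Z k a c - hat Z k b c"])
    fix u v assume "u \<in> Z" "v \<in> Z"
    then show "hat Z k u c - hat Z k v c \<le> k u v"
      using hat_le_step_plus_hat[of Z k u v c] nonneg \<open>c \<in> Z\<close> by simp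
  qed (use assms in auto)
  then show ?thesis by simp
qed

text \<open>If \<open>k\<close> is symmetric, \<open>hat Z k\<close> with its arguments exchanged is again a distance below \<open>k\<close>,
  so it lies below \<open>hat Z k\<close>.\<close>

lemma hat_symmetric:
  fixes k :: "'c \<Rightarrow> 'c \<Rightarrow> real"
  assumes nonneg: "\<And>a b. a \<in> Z \<Longrightarrow> b \<in> Z \<Longrightarrow> 0 \<le> k a b"
    and sym: "\<And>a b. a \<in> Z \<Longrightarrow> b \<in> Z \<Longrightarrow> k a b = k b a"
    and "a \<in> Z" "b \<in> Z"
  shows "hat Z k a b = hat Z k b a"
proof -
  have le: "hat Z k v u \<le> hat Z k u v" if "u \<in> Z" "v \<in> Z" for u v
  proof (rule hat_greatest[where d = "\<lambda>a b. hat Z k b a"])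
    show "hat Z k r p \<le> hat Z k q p + hat Z k r q" if "p \<in> Z" "q \<in> Z" "r \<in> Z" for p q r
      using hat_triangle[of Z k r q p] nonneg that by simp
    show "hat Z k q p \<le> k p q" if "p \<in> Z" "q \<in> Z" for p q
      using hat_le[of Z k q p] nonneg sym[of p q] that by simp
  qed fact+
  show ?thesis using le assms(3,4) by (simp add: antisym)
qed

lemma bridge_nonneg: "bridge X Y F \<Longrightarrow> x \<in> X \<Longrightarrow> y \<in> Y \<Longrightarrow> 0 \<le> F x y"
  unfolding bridge_def by fastforce

lemma bridge_transposed: "bridge X Y F \<Longrightarrow> bridge Y X (transposed F)"
  unfolding bridge_def transposed_def by (smt (verit))

lemma kernel_right_eq_kernel_left: "kernel_right X F = kernel_left X (transposed F)"
  by (simp add: fun_eq_iff kernel_right_def kernel_left_def transposed_def)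

lemma kernel_left_symmetric: "kernel_left Y F a b = kernel_left Y F b a"
  by (simp add: kernel_left_def add.commute)

lemma kernel_left_nonneg:
  assumes "Y \<noteq> {}" "bridge X Y F" "a \<in> X" "b \<in> X"
  shows "0 \<le> kernel_left Y F a b"
  unfolding kernel_left_def
  using assms(1,3,4) by (intro cINF_greatest) (auto intro!: add_nonneg_nonneg bridge_nonneg[OF assms(2)])

lemma kernel_left_le:
  assumes "bridge X Y F" "a \<in> X" "b \<in> X" "y \<in> Y"
  shows "kernel_left Y F a b \<le> F a y + F b y"
  unfolding kernel_left_def
proof (rule cINF_lower)
  show "bdd_below ((\<lambda>y. F a y + F b y) ` Y)"
    using assms(2,3) by (auto intro!: bdd_belowI2[of _ 0] add_nonneg_nonneg bridge_nonneg[OF assms(1)])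
qed fact

lemma hat_kernel_left_le:
  assumes "Y \<noteq> {}" "bridge X Y F" "a \<in> X" "b \<in> X" "y \<in> Y"
  shows "hat X (kernel_left Y F) a b \<le> F a y + F b y"
  using hat_le[of X "kernel_left Y F", OF kernel_left_nonneg[OF assms(1,2)] assms(3,4)]
    kernel_left_le[OF assms(2-5)]
  by simp

text \<open>The bridge condition bounds \<open>F a y - F b y\<close> by each of the sums \<open>F a y' + F b y'\<close>, hence by
  their infimum, the kernel; maximality passes from the kernel to its hat.\<close>

lemma bridge_le_hat_kernel_left:
  assumes "Y \<noteq> {}" "bridge X Y F" "a \<in> X" "b \<in> X" "y \<in> Y"
  shows "F a y \<le> hat X (kernel_left Y F) a b + F b y"
proof -
  have "F a y - F b y \<le> hat X (kernel_left Y F) a b"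
  proof (rule hat_greatest[where d = "\<lambda>a b. F a y - F b y"])
    fix u v assume "u \<in> X" "v \<in> X"
    then have "F u y - F v y \<le> F u y' + F v y'" if "y' \<in> Y" for y'
      using assms(2) that \<open>y \<in> Y\<close> unfolding bridge_def by (smt (verit))
    then show "F u y - F v y \<le> kernel_left Y F u v"
      unfolding kernel_left_def using \<open>Y \<noteq> {}\<close> by (intro cINF_greatest)
  qed (use assms in auto)
  then show ?thesis by simp
qed

theorem lemma4p1:
  fixes X :: "'a set" and Y :: "'b set" and F :: "'a \<Rightarrow> 'b \<Rightarrow> real"
    and \<kappa> :: "'a + 'b \<Rightarrow> 'a + 'b \<Rightarrow> real"
  assumes "X \<noteq> {}" and "Y \<noteq> {}"
    and "bridge X Y F"
  defines "\<kappa> \<equiv> glue (hat X (kernel_left Y F)) F (transposed F) (hat Y (kernel_right X F))"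
  shows "distance_on (X <+> Y) \<kappa> \<and> symmetric_on (X <+> Y) \<kappa>"
proof -
  define p where "p = hat X (kernel_left Y F)"
  define q where "q = hat Y (kernel_right X F)"
  have q_eq: "q = hat Y (kernel_left X (transposed F))"
    by (simp add: q_def kernel_right_eq_kernel_left)
  note bridge' = bridge_transposed[OF \<open>bridge X Y F\<close>]
  note nonneg_X = kernel_left_nonneg[OF \<open>Y \<noteq> {}\<close> \<open>bridge X Y F\<close>]
  note nonneg_Y = kernel_left_nonneg[OF \<open>X \<noteq> {}\<close> bridge']
  note F_nonneg = bridge_nonneg[OF \<open>bridge X Y F\<close>]
  note p_facts =
    hat_nonneg[of X "kernel_left Y F", OF nonneg_X, folded p_def]
    hat_triangle[of X "kernel_left Y F", OF nonneg_X, folded p_def]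
    hat_kernel_left_le[OF \<open>Y \<noteq> {}\<close> \<open>bridge X Y F\<close>, folded p_def]
    bridge_le_hat_kernel_left[OF \<open>Y \<noteq> {}\<close> \<open>bridge X Y F\<close>, folded p_def]
  note q_facts =
    hat_nonneg[of Y "kernel_left X (transposed F)", OF nonneg_Y, folded q_eq]
    hat_triangle[of Y "kernel_left X (transposed F)", OF nonneg_Y, folded q_eq]
    hat_kernel_left_le[OF \<open>X \<noteq> {}\<close> bridge', folded q_eq, unfolded transposed_def]
    bridge_le_hat_kernel_left[OF \<open>X \<noteq> {}\<close> bridge', folded q_eq, unfolded transposed_def]
  have p_sym: "p a b = p b a" if "a \<in> X" "b \<in> X" for a b
    unfolding p_def using that by (intro hat_symmetric nonneg_X kernel_left_symmetric)
  have q_sym: "q a b = q b a" if "a \<in> Y" "b \<in> Y" for a b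
    unfolding q_eq using that by (intro hat_symmetric nonneg_Y kernel_left_symmetric)
  have kappa: "\<kappa> = glue p F (transposed F) q"
    by (simp add: \<kappa>_def p_def q_def)
  have "0 \<le> \<kappa> a b" if "a \<in> X <+> Y" "b \<in> X <+> Y" for a b
    using that by (auto simp: kappa transposed_def p_facts q_facts F_nonneg)
  moreover have sym: "\<kappa> a b = \<kappa> b a" if "a \<in> X <+> Y" "b \<in> X <+> Y" for a b
    using that by (auto simp: kappa transposed_def intro: p_sym q_sym)
  moreover have "\<kappa> a c \<le> \<kappa> a b + \<kappa> b c"
    if "a \<in> X <+> Y" "b \<in> X <+> Y" "c \<in> X <+> Y" for a b c
  proof -
    \<comment> \<open>By symmetry, the mixed inequalities hold with the summands on the right in reverse order.\<close>
    have "F x y \<le> F x y' + q y' y" if "x \<in> X" "y \<in> Y" "y' \<in> Y" for x y y'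
      using q_facts(4)[of y y' x] q_sym[of y y'] that by simp
    moreover have "F x y \<le> F x' y + p x' x" if "x \<in> X" "x' \<in> X" "y \<in> Y" for x x' y
      using p_facts(4)[of x x' y] p_sym[of x x'] that by simp
    ultimately show ?thesis
      using that by (auto simp: kappa transposed_def p_facts q_facts)
  qed
  ultimately show ?thesis
    unfolding distance_on_def symmetric_on_def by blast
qed

end
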